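(* Let $\lambda\in\mathbb{R}$ with $\lambda\neq 0$, let $a\in\mathbb{R}$ with $a\ne 0$ and $|\lambda a|<1$, and let $m\in\mathbb{N}$ (so $m\ge 1$). Then for every $t\in\mathbb{R}$ with $\sin_{\lambda}(2mt:a)\neq 0$ (so that the left-hand side below is defined) and $\sin_{\lambda}\big(t+\frac{j\pi}{2m\log e_{\lambda}(a)}:a\big)\ne 0$ for all $0\le j\le 2m-1$ (so that the right-hand side is defined), $$2m\cot_{\lambda}\big(2mt:a\big)=\sum_{j=0}^{2m-1}\cot_{\lambda}\bigg(t+\frac{j\pi}{2m \log e_{\lambda}(a)}:a\bigg).$$
   Context: For nonzero $\lambda\in\mathbb{R}$, $a\in\mathbb{R}$ with $|\lambda a|<1$, and $z\in\mathbb{C}$, the degenerate exponential is $$e_{\lambda}^{z}(a)=\sum_{n=0}^{\infty}(z)_{n,\lambda}\frac{a^{n}}{n!},\qquad (z)_{0,\lambda}=1,\quad (z)_{n,\lambda}=z(z-\lambda)(z-2\lambda)\cdots(z-(n-1)\lambda)\ (n\ge 1),$$ and $e_{\lambda}(a)=e_{\lambda}^{1}(a)$, which is a positive real number; $\log$ is the real natural logarithm. With $i=\sqrt{-1}$ and $x\in\mathbb{R}$, the degenerate cosine and sine are $$\cos_{\lambda}(x:a)=\frac{e_{\lambda}^{xi}(a)+e_{\lambda}^{-xi}(a)}{2},\qquad \sin_{\lambda}(x:a)=\frac{e_{\lambda}^{xi}(a)-e_{\lambda}^{-xi}(a)}{2i}.$$ The degenerate cotangent is $\cot_{\lambda}(x:a)=\frac{\cos_{\lambda}(x:a)}{\sin_{\lambda}(x:a)}$,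 wherever the denominator is nonzero. *)

theory Defs
  imports "HOL-Analysis.Analysis"
begin

definition deg_fact :: "real \<Rightarrow> complex \<Rightarrow> nat \<Rightarrow> complex" where
  "deg_fact l z n = (\<Prod>k<n. z - of_nat k * of_real l)"

(* The series converges for \<bar>l * a\<bar> < 1, which is the only case of interest. *)
definition deg_exp :: "real \<Rightarrow> complex \<Rightarrow> real \<Rightarrow> complex" where
  "deg_exp l z a = (\<Sum>n. deg_fact l z n * of_real a ^ n / fact n)"

(* The value at exponent z = 1, as a real number, so that the real logarithm applies to it.
   Taking the real part loses nothing, and the value is positive: see of_real_deg_exp1 and
   deg_exp1_pos below. *)
definition deg_exp1 :: "real \<Rightarrow> real \<Rightarrow> real" where
  "deg_exp1 l a = Re (deg_exp l 1 a)"

definition deg_cos :: "real \<Rightarrow> real \<Rightarrow> real \<Rightarrow> complex" where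
  "deg_cos l x a =
     (deg_exp l (of_real x * \<i>) a + deg_exp l (- of_real x * \<i>) a) / 2"

definition deg_sin :: "real \<Rightarrow> real \<Rightarrow> real \<Rightarrow> complex" where
  "deg_sin l x a =
     (deg_exp l (of_real x * \<i>) a - deg_exp l (- of_real x * \<i>) a) / (2 * \<i>)"

(* Meaningful only where deg_sin l x a \<noteq> 0; elsewhere the value is 0 by the convention x / 0 = 0. *)
definition deg_cot :: "real \<Rightarrow> real \<Rightarrow> real \<Rightarrow> complex" where
  "deg_cot l x a = deg_cos l x a / deg_sin l x a"

lemma deg_exp_one_eq:
  assumes "l \<noteq> 0" "\<bar>l * a\<bar> < 1"
  shows "deg_exp l 1 a = of_real ((1 + l * a) powr (1 / l))"
proof -
  have "(\<lambda>n. ((1 / l) gchoose n) * (l * a) ^ n) sums (1 + l * a) powr (1 / l)"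
    using gen_binomial_real[of "l * a" "1 / l"] assms(2) by simp
  then have "(\<lambda>n. complex_of_real (((1 / l) gchoose n) * (l * a) ^ n))
      sums of_real ((1 + l * a) powr (1 / l))"
    by (rule sums_of_real)
  moreover have "complex_of_real (((1 / l) gchoose n) * (l * a) ^ n)
      = deg_fact l 1 n * of_real a ^ n / fact n" for n
  proof -
    have "(\<Prod>i<n. 1 / l - real i) * l ^ n = (\<Prod>i<n. (1 / l - real i) * l)"
      by (simp add: prod.distrib)
    also have "\<dots> = (\<Prod>i<n. 1 - real i * l)"
      using assms(1) by (intro prod.cong) (auto simp: field_simps)
    finally have *: "(\<Prod>i<n. 1 / l - real i) * l ^ n = (\<Prod>i<n. 1 - real i * l)" .
    have "((1 / l) gchoose n) * (l * a) ^ n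
        = ((\<Prod>i<n. 1 / l - real i) * l ^ n) * a ^ n / fact n"
      by (simp add: gbinomial_prod_rev power_mult_distrib atLeast0LessThan)
    then show ?thesis
      unfolding * by (simp add: deg_fact_def)
  qed
  ultimately show ?thesis
    unfolding deg_exp_def by (simp add: sums_iff)
qed

lemma of_real_deg_exp1:
  assumes "l \<noteq> 0" "\<bar>l * a\<bar> < 1"
  shows "of_real (deg_exp1 l a) = deg_exp l 1 a"
  using deg_exp_one_eq[OF assms] by (simp add: deg_exp1_def)

lemma deg_exp1_pos:
  assumes "l \<noteq> 0" "\<bar>l * a\<bar> < 1"
  shows "deg_exp1 l a > 0"
  using deg_exp_one_eq[OF assms] assms(2) by (auto simp: deg_exp1_def)

end

(* Since e_l^z(a) = exp (z L) with L = log e_l(a), the degenerate functions are cos (x L) and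
   sin (x L), and the claim is the classical N cot (N z) = sum_{j<N} cot (z + j pi / N).
   In terms of w = exp (2 i z) one has cot z = 2 i / (1 - 1/w) - i, so it suffices to evaluate
   sum_j 1 / (1 - u r^j) for an N-th root of unity r, which is done by expanding each
   summand as a geometric progression of length N. *)
theory Submission
  imports Defs
begin

lemma sum_powers_root_unity:
  fixes r :: "'a::field"
  assumes "r ^ n = 1" "r \<noteq> 1"
  shows "(\<Sum>j<n. r ^ j) = 0"
  using assms by (simp add: sum_gp_strict)

lemma power_mult_root_unity:
  fixes r u :: "'a::comm_monoid_mult"
  assumes "r ^ n = 1"
  shows "(u * r ^ j) ^ n = u ^ n"
proof -
  have "(r ^ j) ^ n = (r ^ n) ^ j"
    by (simp add: mult.commute flip: power_mult)
  then show ?thesis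
    using assms by (simp add: power_mult_distrib)
qed

text \<open>Every \<open>u * r ^ j\<close> has the same \<open>n\<close>-th power
  \<open>u ^ n\<close>, so \<open>1 - u ^ n\<close> clears all denominators at once and leaves a
  double sum of powers in which \<open>j\<close> can be summed first.\<close>

lemma sum_inverse_one_minus_primitive_root:
  fixes r u :: "'a::field"
  assumes "r ^ n = 1" and prim: "\<And>k. 0 < k \<Longrightarrow> k < n \<Longrightarrow> r ^ k \<noteq> 1" and "u ^ n \<noteq> 1"
  shows "(\<Sum>j<n. 1 / (1 - u * r ^ j)) = of_nat n / (1 - u ^ n)"
proof -
  have n: "n > 0"
    using assms(3) by (cases n) auto
  have pow: "(u * r ^ j) ^ n = u ^ n" for j
    using assms(1) by (rule power_mult_root_unity)
  have expand: "(1 - u ^ n) / (1 - u * r ^ j) = (\<Sum>k<n. u ^ k * (r ^ k) ^ j)" for j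
  proof -
    have "u * r ^ j \<noteq> 1"
      using pow[of j] assms(3) by (metis power_one)
    then show ?thesis
      using sum_gp_strict[of "u * r ^ j" n] pow[of j]
      by (simp add: power_mult_distrib mult.commute flip: power_mult)
  qed
  have "(1 - u ^ n) * (\<Sum>j<n. 1 / (1 - u * r ^ j)) = (\<Sum>j<n. \<Sum>k<n. u ^ k * (r ^ k) ^ j)"
    by (simp add: sum_distrib_left flip: expand)
  also have "\<dots> = (\<Sum>k<n. u ^ k * (\<Sum>j<n. (r ^ k) ^ j))"
    by (subst sum.swap) (simp add: sum_distrib_left)
  \<comment> \<open>Orthogonality: for \<open>0 < k < n\<close>, primitivity gives
    \<open>r ^ k \<noteq> 1\<close>, so the inner sum over all \<open>j\<close> vanishes.\<close>
  also have "\<dots> = (\<Sum>k<n. if k = 0 then of_nat n else 0)"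
  proof (rule sum.cong)
    fix k assume "k \<in> {..<n}"
    moreover have "(r ^ k) ^ n = 1"
      using assms(1) by (metis power_mult mult.commute power_one)
    ultimately show "u ^ k * (\<Sum>j<n. (r ^ k) ^ j) = (if k = 0 then of_nat n else 0)"
      using prim[of k] by (simp add: sum_powers_root_unity)
  qed simp
  also have "\<dots> = of_nat n"
    using n by simp
  finally show ?thesis
    using assms(3) by (simp add: field_simps)
qed

text \<open>In this form \<open>z\<close> enters only through \<open>exp (- (2 * \<i> * z))\<close>,
  which a shift of \<open>z\<close> by \<open>j * pi / n\<close> multiplies by a root of
  unity.\<close>

lemma cot_complex_eq:
  fixes z :: complex
  assumes "sin z \<noteq> 0"
  shows "cot z = 2 * \<i> / (1 - exp (- (2 * \<i> * z))) - \<i>"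
proof -
  define p where "p = exp (\<i> * z)"
  have p: "p \<noteq> 0" "exp (- (\<i> * z)) = inverse p" "exp (- (2 * \<i> * z)) = inverse p ^ 2"
    by (simp_all add: p_def power2_eq_square algebra_simps flip: exp_minus exp_add)
  have sc: "sin z = (p - inverse p) / (2 * \<i>)" "cos z = (p + inverse p) / 2"
    unfolding sin_exp_eq cos_exp_eq p(2)[symmetric] by (simp_all add: p_def)
  \<comment> \<open>Otherwise \<open>p = inverse p\<close>, and the sine would vanish.\<close>
  have "p ^ 2 \<noteq> 1"
    using assms p(1) unfolding sc by (auto simp: field_simps power2_eq_square)
  then have "cot z = \<i> * (p ^ 2 + 1) / (p ^ 2 - 1)"
    using p(1) unfolding cot_def sc by (simp add: divide_simps power2_eq_square)
  also have "\<dots> = 2 * \<i> / (1 - inverse p ^ 2) - \<i>"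
    using \<open>p ^ 2 \<noteq> 1\<close> p(1) by (simp add: field_simps)
  finally show ?thesis
    unfolding p(3) .
qed

text \<open>The sine is \<open>1 - exp (- (2 * \<i> * z))\<close> times a factor that never
  vanishes.\<close>

lemma exp_complex_eq_one_iff_sin_zero:
  fixes z :: complex
  shows "exp (- (2 * \<i> * z)) = 1 \<longleftrightarrow> sin z = 0"
proof -
  have "sin z = exp (\<i> * z) * (1 - exp (- (2 * \<i> * z))) / (2 * \<i>)"
    by (simp add: sin_exp_eq right_diff_distrib flip: exp_add)
  then show ?thesis
    by auto
qed

theorem cot_multiple_angle:
  fixes z :: complex
  assumes "sin (of_nat n * z) \<noteq> 0"
  shows "of_nat n * cot (of_nat n * z) = (\<Sum>j<n. cot (z + of_real (real j * pi / real n)))"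
proof -
  have n: "n > 0"
    using assms by (cases n) auto
  define u where "u = exp (- (2 * \<i> * z))"
  \<comment> \<open>The angle is negative because \<open>u\<close> is built from
    \<open>- 2 * \<i> * z\<close>.\<close>
  define r where "r = cis (- (2 * pi / real n))"
  have un: "u ^ n = exp (- (2 * \<i> * (of_nat n * z)))"
    by (simp add: u_def algebra_simps flip: exp_of_nat_mult)
  then have un1: "u ^ n \<noteq> 1"
    using assms by (simp add: exp_complex_eq_one_iff_sin_zero)
  have rn: "r ^ n = 1"
    using n by (simp add: r_def Complex.DeMoivre complex_eq_iff)
  have prim: "r ^ k \<noteq> 1" if "0 < k" "k < n" for k
  proof
    assume "r ^ k = 1"
    \<comment> \<open>Comparing real parts forces \<open>k / n\<close> to be an integer, impossible
      strictly between 0 and 1.\<close>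
    then have "cos (2 * pi * (real k / real n)) = 1"
      by (simp add: r_def Complex.DeMoivre complex_eq_iff mult_ac)
    then obtain i :: int where "2 * pi * (real k / real n) = of_int i * 2 * pi"
      unfolding cos_one_2pi_int by blast
    then have "real k / real n = of_int i"
      using mult_left_cancel[of "2 * pi" "real k / real n" "of_int i"] by (simp add: mult_ac)
    moreover have "0 < real k / real n" "real k / real n < 1"
      using that by auto
    ultimately show False
      by simp
  qed
  have ur: "exp (- (2 * \<i> * (z + of_real (real j * pi / real n)))) = u * r ^ j" for j
    unfolding u_def r_def Complex.DeMoivre
    unfolding cis_conv_exp by (simp add: algebra_simps flip: exp_add)
  \<comment> \<open>A zero at any shifted point would give \<open>u * r ^ j = 1\<close>, hence
    \<open>u ^ n = 1\<close>.\<close>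
  have "sin (z + of_real (real j * pi / real n)) \<noteq> 0" for j
  proof
    assume "sin (z + of_real (real j * pi / real n)) = 0"
    then have "u * r ^ j = 1"
      by (metis ur exp_complex_eq_one_iff_sin_zero)
    then have "(u * r ^ j) ^ n = 1"
      by simp
    then show False
      using un1 by (simp add: power_mult_root_unity[OF rn])
  qed
  then have "cot (z + of_real (real j * pi / real n)) = 2 * \<i> * (1 / (1 - u * r ^ j)) - \<i>" for j
    using cot_complex_eq ur by simp
  then have "(\<Sum>j<n. cot (z + of_real (real j * pi / real n)))
      = 2 * \<i> * (\<Sum>j<n. 1 / (1 - u * r ^ j)) - of_nat n * \<i>"
    by (simp add: sum_subtractf sum_distrib_left)
  also have "\<dots> = of_nat n * (2 * \<i> / (1 - u ^ n) - \<i>)"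
    using sum_inverse_one_minus_primitive_root[OF rn prim un1] by (simp add: algebra_simps)
  also have "\<dots> = of_nat n * cot (of_nat n * z)"
    using cot_complex_eq[OF assms] un by simp
  finally show ?thesis ..
qed

lemma ln_deg_exp1:
  assumes "l \<noteq> 0" "\<bar>l * a\<bar> < 1"
  shows "ln (deg_exp1 l a) = ln (1 + l * a) / l"
  using assms by (simp add: deg_exp1_def deg_exp_one_eq ln_powr)

text \<open>Pulling \<open>l\<close> out of each factor turns \<open>deg_fact l z n / fact n\<close>
  into \<open>l ^ n\<close> times the binomial coefficient of \<open>z / l\<close>, so the series is
  the binomial series of \<open>(1 + l * a) powr (z / l)\<close>.\<close>

lemma deg_exp_eq:
  assumes "l \<noteq> 0" "\<bar>l * a\<bar> < 1"
  shows "deg_exp l z a = exp (z * of_real (ln (deg_exp1 l a)))"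
proof -
  have summand: "((z / of_real l) gchoose n) * of_real (l * a) ^ n
      = deg_fact l z n * of_real a ^ n / fact n" for n
  proof -
    have "(\<Prod>i<n. z / of_real l - of_nat i) * of_real l ^ n
        = (\<Prod>i<n. (z / of_real l - of_nat i) * of_real l)"
      by (simp add: prod.distrib)
    also have "\<dots> = deg_fact l z n"
      unfolding deg_fact_def using assms(1) by (intro prod.cong) (auto simp: field_simps)
    finally show ?thesis
      by (simp add: gbinomial_prod_rev power_mult_distrib atLeast0LessThan flip: mult.assoc)
  qed
  have "norm (complex_of_real (l * a)) < 1"
    using assms(2) by (simp only: norm_of_real)
  from gen_binomial_complex[OF this, of "z / of_real l"]
  have "deg_exp l z a = (1 + of_real (l * a)) powr (z / of_real l)"
    unfolding deg_exp_def summand by (simp add: sums_iff)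
  also have "\<dots> = complex_of_real (1 + l * a) powr (z / of_real l)"
    by simp
  \<comment> \<open>Since \<open>1 + l * a > 0\<close>, the principal complex logarithm is the real
    one.\<close>
  also have "\<dots> = exp (z / of_real l * of_real (ln (1 + l * a)))"
    using assms(2) by (subst powr_def) (auto simp: Ln_of_real simp del: of_real_add of_real_mult)
  finally show ?thesis
    by (simp add: ln_deg_exp1[OF assms])
qed

lemma deg_sin_eq:
  assumes "l \<noteq> 0" "\<bar>l * a\<bar> < 1"
  shows "deg_sin l x a = sin (of_real (x * ln (deg_exp1 l a)))"
  by (simp add: deg_sin_def deg_exp_eq[OF assms] sin_exp_eq mult_ac)

lemma deg_cos_eq:
  assumes "l \<noteq> 0" "\<bar>l * a\<bar> < 1"
  shows "deg_cos l x a = cos (of_real (x * ln (deg_exp1 l a)))"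
  by (simp add: deg_cos_def deg_exp_eq[OF assms] cos_exp_eq mult_ac)

lemma deg_cot_eq:
  assumes "l \<noteq> 0" "\<bar>l * a\<bar> < 1"
  shows "deg_cot l x a = cot (of_real (x * ln (deg_exp1 l a)))"
  by (simp only: deg_cot_def cot_def deg_sin_eq[OF assms] deg_cos_eq[OF assms])

theorem theorem2p4:
  fixes l a t :: real and m :: nat
  assumes "l \<noteq> 0" and "a \<noteq> 0" and "\<bar>l * a\<bar> < 1" and "m \<ge> 1"
    and "deg_sin l (2 * real m * t) a \<noteq> 0"
    and "\<forall>j \<in> {0..2 * m - 1}.
           deg_sin l (t + real j * pi / (2 * real m * ln (deg_exp1 l a))) a \<noteq> 0"
  shows "2 * of_nat m * deg_cot l (2 * real m * t) a =
    (\<Sum>j = 0..2 * m - 1. deg_cot l (t + real j * pi / (2 * real m * ln (deg_exp1 l a))) a)"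
proof -
  define L where "L = ln (deg_exp1 l a)"
  \<comment> \<open>\<open>L = ln (1 + l * a) / l\<close> vanishes only for
    \<open>l * a = 0\<close>; this is where \<open>a \<noteq> 0\<close> enters.\<close>
  have "L \<noteq> 0"
    using assms(1-3) by (auto simp: L_def ln_deg_exp1)
  have mult: "of_nat (2 * m) * of_real (t * L) = complex_of_real (2 * real m * t * L)"
    by simp
  have "(\<Sum>j = 0..2 * m - 1. deg_cot l (t + real j * pi / (2 * real m * L)) a)
      = (\<Sum>j<2 * m. cot (of_real (t * L) + of_real (real j * pi / real (2 * m))))"
  proof (rule sum.cong)
    fix j
    \<comment> \<open>The factor \<open>L\<close> in the angle cancels the \<open>L\<close> dividing
      the shift, leaving the classical shift by \<open>j * pi / (2 * m)\<close>.\<close>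
    have "(t + real j * pi / (2 * real m * L)) * L = t * L + real j * pi / real (2 * m)"
      using \<open>L \<noteq> 0\<close> by (simp add: field_simps)
    then show "deg_cot l (t + real j * pi / (2 * real m * L)) a
        = cot (of_real (t * L) + of_real (real j * pi / real (2 * m)))"
      by (simp only: deg_cot_eq[OF assms(1,3)] flip: L_def of_real_add)
  \<comment> \<open>With truncated subtraction, \<open>{0..2 * m - 1}\<close> is
    \<open>{..<2 * m}\<close> only because \<open>m \<ge> 1\<close>.\<close>
  qed (use assms(4) in auto)
  also have "\<dots> = of_nat (2 * m) * cot (of_nat (2 * m) * of_real (t * L))"
    using assms(5) unfolding deg_sin_eq[OF assms(1,3)] L_def[symmetric] mult[symmetric]
    by (rule cot_multiple_angle[symmetric])
  also have "\<dots> = 2 * of_nat m * deg_cot l (2 * real m * t) a"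
    unfolding deg_cot_eq[OF assms(1,3)] L_def[symmetric] mult by simp
  finally show ?thesis
    unfolding L_def ..
qed

end
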